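(* Consider the finite-horizon linear quadratic tracking (LQT) problem: compute an optimal control law $\boldsymbol{u}^*(t)$ which minimizes $$J=\tfrac12\,\boldsymbol{e}^T(t_f)F(t_f)\boldsymbol{e}(t_f)+\tfrac12\int_{t_0}^{t_f}\big(\boldsymbol{e}^T(t)Q(t)\boldsymbol{e}(t)+\boldsymbol{u}^T(t)R(t)\boldsymbol{u}(t)\big)\,dt,\qquad \boldsymbol{e}(t)=\boldsymbol{y}(t)-\boldsymbol{z}(t),$$ subject to $\dot{\boldsymbol{x}}(t)=A(t)\boldsymbol{x}(t)+B(t)\boldsymbol{u}(t)$, $\boldsymbol{y}(t)=C(t)\boldsymbol{x}(t)$, such that the output $\boldsymbol{y}(t)$ tracks the desired reference trajectory $\boldsymbol{z}(t)$, where $\boldsymbol{x}(t_0)=\boldsymbol{x}_0$ is given, $\boldsymbol{x}(t_f)$ is free, $t_f$ is fixed, and $Q(t)\succeq0$, $R(t)\succ0$ for all $t\in[t_0,t_f]$. Let the Krotov function be selected as $$q(\boldsymbol{x},t)=\boldsymbol{x}^TP(t)\boldsymbol{x}-2\boldsymbol{g}^T(t)\boldsymbol{x},$$ where every element of the matrix $P(t)$ and of the vector $\boldsymbol{g}(t)$ is differentiable for all $t\in[t_0,t_f)$. Then the following statements are true: 1. The function $q=\boldsymbol{x}^TP\boldsymbol{x}-2\boldsymbol{g}^T\boldsymbol{x}$ is a solving function for the LQT problem (as defined in the context). 2. The global optimal control law for the LQT problem is given by $$\boldsymbol{u}^*=-\tfrac12R^{-1}B^T\big(P^T+P\big)\boldsymbol{x}+R^{-1}B^T\boldsymbol{g},$$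 where $P$ is the solution of the matrix differential equation $$\dot P+PA+A^TP-\tfrac12PBR^{-1}B^TP-\tfrac14PBR^{-1}B^TP^T-\tfrac14P^TBR^{-1}B^TP+C^TQC=0$$ with the final value $P(t_f)=C^T(t_f)F(t_f)C(t_f)$, and $\boldsymbol{g}(t)$ satisfies the differential equation $$\dot{\boldsymbol{g}}+A^T\boldsymbol{g}+C^TQ\boldsymbol{z}-\tfrac12(P+P^T)BR^{-1}B^T\boldsymbol{g}=\boldsymbol{0}$$ with the final value $\boldsymbol{g}(t_f)=C^T(t_f)F(t_f)\boldsymbol{z}(t_f)$.
   Context: Here $\boldsymbol{x}(t)\in\mathbb{R}^n$ is the state, $\boldsymbol{u}(t)\in\mathbb{R}^m$ is the control input, $\boldsymbol{y}(t)$ is the output, $\boldsymbol{z}(t)$ is the given reference trajectory, $A,B,C,Q,R$ are matrices of compatible sizes depending on $t$, $F(t_f)$ is a square matrix of the size of $\boldsymbol{e}$, $P(t)$ is an $n\times n$ matrix (not required to be symmetric or positive definite), $\boldsymbol{g}(t)\in\mathbb{R}^n$, and the argument $t$ is often dropped. $M\succeq0$ / $M\succ0$ denote positive semidefinite / positive definite. An admissible process is a pair $(\boldsymbol{x}(t),\boldsymbol{u}(t))$ which satisfies the dynamical equation (with the given initial state) and the input/state constraints; here no input or state constraints are imposed. Solving function: for a Krotov function $q(\boldsymbol{x},t)$ (in general, any continuously differentiable function), and using $2J$ as the cost functional in place of $J$, put $$s(\boldsymbol{x},\boldsymbol{u},t)=\frac{\partial q}{\partial t}+\frac{\partial q}{\partial\boldsymbol{x}}[A\boldsymbol{x}+B\boldsymbol{u}]+\boldsymbol{e}^TQ\boldsymbol{e}+\boldsymbol{u}^TR\boldsymbol{u},\qquad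 s_f(\boldsymbol{x}(t_f))=\boldsymbol{e}^T(t_f)F(t_f)\boldsymbol{e}(t_f)-q(\boldsymbol{x}(t_f),t_f),$$ with $\boldsymbol{e}=C\boldsymbol{x}-\boldsymbol{z}$. The equivalent optimization problem is to find an admissible process $(\boldsymbol{x}^*,\boldsymbol{u}^* )$ which attains $\min_{(\boldsymbol{x},\boldsymbol{u})\in\mathbb{R}^n\times\mathbb{R}^m}s(\boldsymbol{x},\boldsymbol{u},t)$ for all $t\in[t_0,t_f)$ and $\min_{\boldsymbol{x}\in\mathbb{R}^n}s_f(\boldsymbol{x})$ at $t=t_f$. The function $q$ is called a solving function if this problem is feasible, i.e. if an admissible process attaining these minima can be found.
   Formalization: F(t_f) is assumed symmetric (for antisymmetric F with z(t_f)≠0 the claim can fail; other valid cases reduce to symmetric parts of F and P), and A, B, C, Q, R, z are assumed continuous on [t_0,t_f], with P and g continuous up to t_f. *)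

theory Defs
  imports "HOL-Analysis.Analysis"
begin

text \<open>Definiteness of a matrix includes its symmetry.\<close>

definition pos_semidef :: "real^'k^'k \<Rightarrow> bool" where
  "pos_semidef M \<longleftrightarrow> transpose M = M \<and> (\<forall>v. 0 \<le> v \<bullet> (M *v v))"

definition pos_def :: "real^'k^'k \<Rightarrow> bool" where
  "pos_def M \<longleftrightarrow> transpose M = M \<and> (\<forall>v. v \<noteq> 0 \<longrightarrow> 0 < v \<bullet> (M *v v))"

text \<open>
  A process \<open>(x, u)\<close> for the dynamics \<open>x' = f t x u\<close>: the trajectory is continuous and satisfies the
  differential equation at all but finitely many times, so that piecewise continuous controls are
  covered. Integrability of the running cost \<open>L\<close> is what makes the cost of the process meaningful
  (\<open>integral\<close> is \<open>0\<close> on functions that are not integrable).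
\<close>

definition admissible_process ::
  "real \<Rightarrow> real \<Rightarrow> 'x::euclidean_space \<Rightarrow> (real \<Rightarrow> 'x \<Rightarrow> 'u::euclidean_space \<Rightarrow> 'x)
    \<Rightarrow> (real \<Rightarrow> 'x \<Rightarrow> 'u \<Rightarrow> real) \<Rightarrow> (real \<Rightarrow> 'x) \<Rightarrow> (real \<Rightarrow> 'u) \<Rightarrow> bool" where
  "admissible_process t0 tf x0 f L x u \<longleftrightarrow>
     continuous_on {t0..tf} x \<and> x t0 = x0 \<and>
     (\<exists>D. finite D \<and> (\<forall>t\<in>{t0..tf} - D.
        (x has_vector_derivative f t (x t) (u t)) (at t within {t0..tf}))) \<and>
     (\<lambda>t. L t (x t) (u t)) integrable_on {t0..tf}"

text \<open>
  Continuously differentiable functions \<open>q(x, t)\<close>: class \<open>C\<^sup>1\<close> for \<open>t0 \<le> t < tf\<close> (one-sided in time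
  at \<open>t0\<close>), and continuous up to the final time.
\<close>

definition krotov_function :: "real \<Rightarrow> real \<Rightarrow> ('x::euclidean_space \<Rightarrow> real \<Rightarrow> real) \<Rightarrow> bool" where
  "krotov_function t0 tf q \<longleftrightarrow>
     continuous_on (UNIV \<times> {t0..tf}) (\<lambda>(x, t). q x t) \<and>
     (\<exists>qx qt. continuous_on (UNIV \<times> {t0..<tf}) qx \<and> continuous_on (UNIV \<times> {t0..<tf}) qt \<and>
        (\<forall>x. \<forall>t\<in>{t0..<tf}.
           ((\<lambda>(y, \<tau>). q y \<tau>) has_derivative (\<lambda>(h, k). qx (x, t) \<bullet> h + qt (x, t) * k))
             (at (x, t) within UNIV \<times> {t0..tf})))"

definition krotov_s ::
  "real \<Rightarrow> real \<Rightarrow> (real \<Rightarrow> 'x::euclidean_space \<Rightarrow> 'u::euclidean_space \<Rightarrow> 'x)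
    \<Rightarrow> (real \<Rightarrow> 'x \<Rightarrow> 'u \<Rightarrow> real) \<Rightarrow> ('x \<Rightarrow> real \<Rightarrow> real) \<Rightarrow> 'x \<Rightarrow> 'u \<Rightarrow> real \<Rightarrow> real" where
  "krotov_s t0 tf f L q x u t =
     vector_derivative (\<lambda>\<tau>. q x \<tau>) (at t within {t0..tf})
     + frechet_derivative (\<lambda>y. q y t) (at x) (f t x u) + L t x u"

definition krotov_sf ::
  "real \<Rightarrow> ('x::euclidean_space \<Rightarrow> real) \<Rightarrow> ('x \<Rightarrow> real \<Rightarrow> real) \<Rightarrow> 'x \<Rightarrow> real" where
  "krotov_sf tf \<Phi> q x = \<Phi> x - q x tf"

definition solving_function ::
  "real \<Rightarrow> real \<Rightarrow> 'x::euclidean_space \<Rightarrow> (real \<Rightarrow> 'x \<Rightarrow> 'u::euclidean_space \<Rightarrow> 'x)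
    \<Rightarrow> (real \<Rightarrow> 'x \<Rightarrow> 'u \<Rightarrow> real) \<Rightarrow> ('x \<Rightarrow> real) \<Rightarrow> ('x \<Rightarrow> real \<Rightarrow> real) \<Rightarrow> bool" where
  "solving_function t0 tf x0 f L \<Phi> q \<longleftrightarrow>
     krotov_function t0 tf q \<and>
     (\<exists>x u. admissible_process t0 tf x0 f L x u \<and>
        (\<forall>t\<in>{t0..<tf}. \<forall>\<xi> v. krotov_s t0 tf f L q (x t) (u t) t \<le> krotov_s t0 tf f L q \<xi> v t) \<and>
        (\<forall>\<xi>. krotov_sf tf \<Phi> q (x tf) \<le> krotov_sf tf \<Phi> q \<xi>))"

definition lqt_dynamics ::
  "(real \<Rightarrow> real^'n^'n) \<Rightarrow> (real \<Rightarrow> real^'m^'n) \<Rightarrow> real \<Rightarrow> real^'n \<Rightarrow> real^'m \<Rightarrow> real^'n" where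
  "lqt_dynamics A B t x u = A t *v x + B t *v u"

definition lqt_error :: "(real \<Rightarrow> real^'n^'p) \<Rightarrow> (real \<Rightarrow> real^'p) \<Rightarrow> real \<Rightarrow> real^'n \<Rightarrow> real^'p" where
  "lqt_error C z t x = C t *v x - z t"

text \<open>
  The running and the terminal cost carry no factor \<open>1/2\<close>: the Krotov functions above are taken for
  \<open>2J\<close>, and \<open>J\<close> itself is \<open>lqt_cost\<close>.
\<close>

definition lqt_running ::
  "(real \<Rightarrow> real^'n^'p) \<Rightarrow> (real \<Rightarrow> real^'p^'p) \<Rightarrow> (real \<Rightarrow> real^'m^'m) \<Rightarrow> (real \<Rightarrow> real^'p)
    \<Rightarrow> real \<Rightarrow> real^'n \<Rightarrow> real^'m \<Rightarrow> real" where
  "lqt_running C Q R z t x u =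
     lqt_error C z t x \<bullet> (Q t *v lqt_error C z t x) + u \<bullet> (R t *v u)"

definition lqt_terminal ::
  "(real \<Rightarrow> real^'n^'p) \<Rightarrow> (real \<Rightarrow> real^'p^'p) \<Rightarrow> (real \<Rightarrow> real^'p) \<Rightarrow> real \<Rightarrow> real^'n \<Rightarrow> real" where
  "lqt_terminal C F z tf x = lqt_error C z tf x \<bullet> (F tf *v lqt_error C z tf x)"

definition lqt_cost ::
  "(real \<Rightarrow> real^'n^'p) \<Rightarrow> (real \<Rightarrow> real^'p^'p) \<Rightarrow> (real \<Rightarrow> real^'m^'m) \<Rightarrow> (real \<Rightarrow> real^'p^'p)
    \<Rightarrow> (real \<Rightarrow> real^'p) \<Rightarrow> real \<Rightarrow> real \<Rightarrow> (real \<Rightarrow> real^'n) \<Rightarrow> (real \<Rightarrow> real^'m) \<Rightarrow> real" where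
  "lqt_cost C Q R F z t0 tf x u =
     1/2 * lqt_terminal C F z tf (x tf)
     + 1/2 * integral {t0..tf} (\<lambda>t. lqt_running C Q R z t (x t) (u t))"

text \<open>
  A feedback law \<open>\<kappa> t x\<close> is globally optimal if it generates an admissible process from \<open>x0\<close> and
  every process it generates minimizes \<open>J\<close> among all admissible processes.
\<close>

definition lqt_global_optimal_law ::
  "(real \<Rightarrow> real^'n^'n) \<Rightarrow> (real \<Rightarrow> real^'m^'n) \<Rightarrow> (real \<Rightarrow> real^'n^'p) \<Rightarrow> (real \<Rightarrow> real^'p^'p)
    \<Rightarrow> (real \<Rightarrow> real^'m^'m) \<Rightarrow> (real \<Rightarrow> real^'p^'p) \<Rightarrow> (real \<Rightarrow> real^'p) \<Rightarrow> real \<Rightarrow> real \<Rightarrow> real^'n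
    \<Rightarrow> (real \<Rightarrow> real^'n \<Rightarrow> real^'m) \<Rightarrow> bool" where
  "lqt_global_optimal_law A B C Q R F z t0 tf x0 \<kappa> \<longleftrightarrow>
     (let adm = admissible_process t0 tf x0 (lqt_dynamics A B) (lqt_running C Q R z);
          J = lqt_cost C Q R F z t0 tf
      in (\<exists>x. adm x (\<lambda>t. \<kappa> t (x t))) \<and>
         (\<forall>x. adm x (\<lambda>t. \<kappa> t (x t)) \<longrightarrow>
            (\<forall>x' u'. adm x' u' \<longrightarrow> J x (\<lambda>t. \<kappa> t (x t)) \<le> J x' u')))"

end

theory Submission
  imports Defs
begin

text \<open>
  Add to the cost \<open>2J\<close> of a process the integral of the total time derivative of \<open>q (x t) t\<close> and
  subtract the corresponding boundary values of \<open>q\<close>. This changes nothing, but it rewrites \<open>2J\<close> as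
  \<open>krotov_sf\<close> at the final state, plus the integral of \<open>krotov_s\<close>, plus a constant fixed by the initial
  state (\<open>krotov_s_has_integral\<close>). A process that minimizes both functions pointwise over all states
  and controls is therefore globally optimal (\<open>krotov_minimizer_optimal\<close>).

  For \<open>q = x\<^sup>T P x - 2 g\<^sup>T x\<close> the differential equations for \<open>P\<close> and \<open>g\<close> are exactly what is needed for
  every term in the state to cancel after completing the square in the control
  (\<open>lqt_completed_square\<close>): with \<open>u*\<close> the feedback value at \<open>x\<close>,
  \<open>krotov_s = (u - u*)\<^sup>T R (u - u*) + c t\<close>, where \<open>c t\<close> depends on time only. Likewise, the final
  values of \<open>P\<close> and \<open>g\<close> make \<open>krotov_sf\<close> constant (\<open>lqt_terminal_completed_square\<close>). As \<open>R\<close> is positive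
  definite, \<open>u = u*\<close> attains the minimum at every state. Hence every process generated by the
  feedback law attains both minima, and only the existence of such a process is left: the closed
  loop is a linear differential equation with continuous coefficients
  (\<open>lqt_closed_loop_admissible\<close>), solved by the contraction principle
  (\<open>lipschitz_ivp_solution_exists\<close>).
\<close>

section \<open>Matrix functions of time\<close>

lemma bounded_bilinear_matrix_vector_mult:
  "bounded_bilinear ((*v) :: real^'n^'m \<Rightarrow> real^'n \<Rightarrow> real^'m)"
  unfolding bilinear_conv_bounded_bilinear[symmetric] bilinear_def
  by (auto intro!: linearI simp: algebra_simps simp flip: scaleR_matrix_vector_assoc)

lemmas continuous_on_matrix_vector_mult [continuous_intros] =
  bounded_bilinear.continuous_on[OF bounded_bilinear_matrix_vector_mult]

lemma continuous_on_matrix_matrix_mult [continuous_intros]: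
  fixes M :: "'a::topological_space \<Rightarrow> real^'n^'m" and N :: "'a \<Rightarrow> real^'k^'n"
  assumes "continuous_on S M" "continuous_on S N"
  shows "continuous_on S (\<lambda>t. M t ** N t)"
  unfolding matrix_matrix_mult_def by (intro continuous_intros assms)

lemma continuous_on_matrix_transpose [continuous_intros]:
  fixes M :: "'a::topological_space \<Rightarrow> real^'n^'m"
  assumes "continuous_on S M"
  shows "continuous_on S (\<lambda>t. transpose (M t))"
  unfolding transpose_def by (intro continuous_intros assms)

lemma continuous_on_det [continuous_intros]:
  fixes M :: "'a::topological_space \<Rightarrow> real^'n^'n"
  assumes "continuous_on S M"
  shows "continuous_on S (\<lambda>t. det (M t))"
  unfolding det_def by (intro continuous_intros assms)

lemma matrix_inv_inverse:
  assumes "invertible M"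
  shows "M ** matrix_inv M = mat 1" "matrix_inv M ** M = mat 1"
  using someI_ex[OF assms[unfolded invertible_def]] unfolding matrix_inv_def by auto

text \<open>
  By Cramer's rule each entry of the inverse is a quotient of determinants, hence of polynomials in
  the entries of the matrix.
\<close>

lemma continuous_on_matrix_inv:
  fixes M :: "'a::topological_space \<Rightarrow> real^'n^'n"
  assumes cont: "continuous_on S M" and inv: "\<And>t. t \<in> S \<Longrightarrow> invertible (M t)"
  shows "continuous_on S (\<lambda>t. matrix_inv (M t))"
proof -
  have "matrix_inv (M t) $ i $ j
      = det (\<chi> i' j'. if j' = i then axis j 1 $ i' else M t $ i' $ j') / det (M t)"
    if "t \<in> S" for t i j
  proof -
    have "M t *v (matrix_inv (M t) *v axis j 1) = axis j 1"
      by (simp add: matrix_vector_mul_assoc matrix_inv_inverse[OF inv[OF that]])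
    then have "(matrix_inv (M t) *v axis j 1) $ i
      = det (\<chi> i' j'. if j' = i then axis j 1 $ i' else M t $ i' $ j') / det (M t)"
      using inv[OF that] by (subst (asm) cramer) (auto simp: invertible_det_nz)
    then show ?thesis
      by (simp add: matrix_vector_mult_basis column_def)
  qed
  then have entry: "continuous_on S (\<lambda>t. matrix_inv (M t) $ i $ j)" for i j
  proof (rule continuous_on_cong[OF refl, THEN iffD2])
    have "continuous_on S (\<lambda>t. if j' = i then axis j 1 $ i' else M t $ i' $ j')" for i' j'
      by (cases "j' = i") (auto intro!: continuous_intros cont)
    then show "continuous_on S
        (\<lambda>t. det (\<chi> i' j'. if j' = i then axis j 1 $ i' else M t $ i' $ j') / det (M t))"
      using inv by (auto intro!: continuous_intros cont simp: invertible_det_nz)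
  qed
  have "continuous_on S (\<lambda>t. \<chi> i j. matrix_inv (M t) $ i $ j)"
    by (intro continuous_intros entry)
  then show ?thesis
    by simp
qed

lemma pos_def_invertible:
  assumes "pos_def M"
  shows "invertible M"
proof -
  have "x = 0" if "M *v x = 0" for x
    using assms that by (metis inner_zero_right less_irrefl pos_def_def)
  then show ?thesis
    unfolding invertible_left_inverse matrix_left_invertible_ker by blast
qed

lemma transpose_matrix_inv:
  fixes M :: "real^'n^'n"
  assumes "invertible M" "transpose M = M"
  shows "transpose (matrix_inv M) = matrix_inv M"
proof -
  have "transpose (matrix_inv M) ** M = mat 1"
    by (metis assms matrix_inv_inverse(1) matrix_transpose_mul transpose_mat)
  then show ?thesis
    by (metis assms(1) matrix_inv_inverse(1) matrix_mul_assoc matrix_mul_lid matrix_mul_rid)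
qed

lemma inner_matrix_vector_transpose:
  fixes M :: "real^'n^'m"
  shows "y \<bullet> (M *v x) = (transpose M *v y) \<bullet> x"
  by (simp add: dot_lmul_matrix)

section \<open>Linear differential equations\<close>

text \<open>
  Picard-Lindeloef on the whole interval at once: with a bound \<open>K\<close> that is uniform in time, no gluing
  of short-time solutions is needed if the Picard operator is considered on \<open>y t = exp (- l (t - a)) x t\<close>
  in place of \<open>x\<close>. The exponential weight makes the operator a contraction with factor \<open>\<bar>K\<bar> / l\<close>.
\<close>

lemma lipschitz_ivp_solution_exists:
  fixes f :: "real \<Rightarrow> 'x::banach \<Rightarrow> 'x"
  assumes "a \<le> b"
    and cont: "continuous_on ({a..b} \<times> UNIV) (\<lambda>(t, x). f t x)"
    and lipschitz: "\<And>t x y. t \<in> {a..b} \<Longrightarrow> norm (f t x - f t y) \<le> K * norm (x - y)"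
  obtains x where "x a = x0"
    and "\<And>t. t \<in> {a..b} \<Longrightarrow> (x has_vector_derivative f t (x t)) (at t within {a..b})"
proof -
  \<comment> \<open>The summand \<open>1\<close> makes the rate positive even for \<open>K = 0\<close> and the factor \<open>\<bar>K\<bar> / l\<close> smaller than one.\<close>
  define l where "l = \<bar>K\<bar> + 1"
  have l: "0 < l" "\<bar>K\<bar> / l < 1" "0 \<le> \<bar>K\<bar> / l"
    by (auto simp: l_def)
  define rhs where "rhs y s = f s (exp (l * (s - a)) *\<^sub>R apply_bcontfun y s)" for y :: "real \<Rightarrow>\<^sub>C 'x" and s
  define W where "W y t = exp (- l * (t - a)) *\<^sub>R (x0 + integral {a..t} (rhs y))" for y t
  have rhs_cont: "continuous_on {a..b} (rhs y)" for y
    unfolding rhs_def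
    by (rule continuous_on_compose2[OF cont, where f = "\<lambda>s. (s, _ s)", simplified])
      (auto intro!: continuous_intros)
  have rhs_int: "rhs y integrable_on {a..t}" if "t \<in> {a..b}" for y t
    using that by (intro integrable_continuous_real continuous_on_subset[OF rhs_cont]) auto
  have W_cont: "continuous_on (cbox a b) (W y)" for y
    unfolding W_def
    using indefinite_integral_continuous_1[OF rhs_int[of b y]] \<open>a \<le> b\<close>
    by (auto intro!: continuous_intros)
  \<comment> \<open>Beyond the interval, functions are continued by their values at the end points, so that
    they are bounded continuous functions on the whole line, which form a complete space.\<close>
  have "\<exists>h. \<forall>t. apply_bcontfun h t = W y (clamp a b t)" for y
    by (rule continuous_on_cbox_bcontfunE[OF W_cont]) blast
  then obtain T where T: "\<And>y t. apply_bcontfun (T y) t = W y (clamp a b t)"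
    by metis
  have W_dist: "dist (W y t) (W y' t) \<le> \<bar>K\<bar> / l * dist y y'" if t: "t \<in> {a..b}" for y y' t
  proof -
    have prim: "((\<lambda>s. \<bar>K\<bar> * exp (l * (s - a)) * dist y y') has_integral
        \<bar>K\<bar> / l * exp (l * (t - a)) * dist y y' - \<bar>K\<bar> / l * exp (l * (a - a)) * dist y y') {a..t}"
      using t l
      by (intro fundamental_theorem_of_calculus)
        (auto intro!: derivative_eq_intros simp: has_real_derivative_iff_has_vector_derivative[symmetric])
    have "norm (rhs y s - rhs y' s) \<le> \<bar>K\<bar> * exp (l * (s - a)) * dist y y'" if s: "s \<in> {a..t}" for s
    proof -
      have "norm (rhs y s - rhs y' s)
          \<le> K * norm (exp (l * (s - a)) *\<^sub>R apply_bcontfun y s - exp (l * (s - a)) *\<^sub>R apply_bcontfun y' s)"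
        unfolding rhs_def using s t by (intro lipschitz) auto
      also have "\<dots> = K * (exp (l * (s - a)) * dist (apply_bcontfun y s) (apply_bcontfun y' s))"
        by (simp add: dist_norm flip: scaleR_diff_right)
      also have "\<dots> \<le> \<bar>K\<bar> * (exp (l * (s - a)) * dist y y')"
        by (intro mult_mono mult_left_mono dist_bounded) auto
      finally show ?thesis by (simp add: mult.assoc)
    qed
    then have "norm (integral {a..t} (\<lambda>s. rhs y s - rhs y' s))
        \<le> integral {a..t} (\<lambda>s. \<bar>K\<bar> * exp (l * (s - a)) * dist y y')"
      using rhs_int[OF t] prim
      by (intro integral_norm_bound_integral integrable_diff) (auto simp: has_integral_integrable)
    also have "\<dots> \<le> exp (l * (t - a)) * (\<bar>K\<bar> / l * dist y y')"
      unfolding integral_unique[OF prim] using l by (simp add: mult_ac)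
    finally have "norm (integral {a..t} (rhs y) - integral {a..t} (rhs y'))
        \<le> exp (l * (t - a)) * (\<bar>K\<bar> / l * dist y y')"
      by (simp add: integral_diff rhs_int[OF t])
    then have "exp (- l * (t - a)) * norm (integral {a..t} (rhs y) - integral {a..t} (rhs y'))
        \<le> exp (- l * (t - a)) * (exp (l * (t - a)) * (\<bar>K\<bar> / l * dist y y'))"
      by (intro mult_left_mono) auto
    also have "\<dots> = \<bar>K\<bar> / l * dist y y'"
      by (simp add: mult.assoc[symmetric] flip: exp_add)
    finally show ?thesis
      by (simp add: W_def dist_norm flip: scaleR_diff_right)
  qed
  have "dist (T y) (T y') \<le> \<bar>K\<bar> / l * dist y y'" for y y'
    by (rule dist_bound, unfold T, rule W_dist) (use \<open>a \<le> b\<close> clamp_in_interval[of a b] in auto)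
  then obtain y where y: "T y = y"
    using banach_fix_type[of "\<bar>K\<bar> / l" T] l by blast
  define x where "x t = x0 + integral {a..t} (rhs y)" for t
  have rhs_x: "rhs y t = f t (x t)" if "t \<in> {a..b}" for t
  proof -
    have "apply_bcontfun y t = exp (- l * (t - a)) *\<^sub>R x t"
      using T[of y t] that by (simp add: y W_def x_def)
    then show ?thesis
      by (simp add: rhs_def flip: exp_add)
  qed
  have "x a = x0"
    by (simp add: x_def)
  moreover have "(x has_vector_derivative f t (x t)) (at t within {a..b})" if t: "t \<in> {a..b}" for t
    unfolding x_def[abs_def] rhs_x[OF t, symmetric, unfolded x_def]
    by (auto intro!: derivative_eq_intros integral_has_vector_derivative rhs_cont t)
  ultimately show thesis
    by (rule that)
qed

lemma linear_ivp_solution_exists: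
  fixes G :: "real \<Rightarrow> real^'n^'n"
  assumes "a \<le> b" and G: "continuous_on {a..b} G" and h: "continuous_on {a..b} h"
  obtains x where "x a = x0"
    and "\<And>t. t \<in> {a..b} \<Longrightarrow> (x has_vector_derivative G t *v x t + h t) (at t within {a..b})"
proof -
  obtain k where k: "0 \<le> k" "\<And>(M :: real^'n^'n) v. norm (M *v v) \<le> norm M * norm v * k"
    using bounded_bilinear.nonneg_bounded[OF bounded_bilinear_matrix_vector_mult] by metis
  obtain c where c: "\<And>t. t \<in> {a..b} \<Longrightarrow> norm (G t) \<le> c"
    using compact_imp_bounded[OF compact_continuous_image[OF G compact_Icc]]
    unfolding bounded_iff by blast
  have fst: "continuous_on ({a..b} \<times> UNIV) (\<lambda>p. H (fst p))"
    if "continuous_on {a..b} H" for H :: "real \<Rightarrow> 'b::topological_space"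
    by (rule continuous_on_compose2[OF that]) (auto intro!: continuous_intros)
  have "continuous_on ({a..b} \<times> UNIV) (\<lambda>(t, x). G t *v x + h t)"
    unfolding case_prod_beta' by (intro continuous_intros fst G h)
  moreover have "norm ((G t *v x + h t) - (G t *v y + h t)) \<le> (c * k) * norm (x - y)"
    if "t \<in> {a..b}" for t x y
  proof -
    have "norm (G t *v (x - y)) \<le> norm (G t) * norm (x - y) * k"
      by (rule k)
    also have "\<dots> \<le> c * norm (x - y) * k"
      by (intro mult_right_mono c that k) auto
    finally show ?thesis
      by (simp add: matrix_vector_mult_diff_distrib mult.commute mult.left_commute)
  qed
  ultimately show thesis
    using lipschitz_ivp_solution_exists[OF \<open>a \<le> b\<close>] that by blast
qed

section \<open>Krotov's sufficient condition\<close>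

text \<open>
  A joint derivative of \<open>q\<close> in \<open>(x, t)\<close> determines both partial derivatives that enter \<open>krotov_s\<close>.
\<close>

lemma krotov_s_eq:
  assumes "t0 < tf" and t: "t \<in> {t0..tf}"
    and der: "((\<lambda>(y, \<tau>). q y \<tau>) has_derivative (\<lambda>(h, k). a \<bullet> h + c * k)) (at (x, t) within UNIV \<times> {t0..tf})"
  shows "krotov_s t0 tf f L q x u t = c + a \<bullet> f t x u + L t x u"
proof -
  have "((\<lambda>\<tau>. (\<lambda>(y, \<tau>). q y \<tau>) (x, \<tau>)) has_derivative (\<lambda>k. (\<lambda>(h, k). a \<bullet> h + c * k) (0, k))) (at t within {t0..tf})"
    by (rule has_derivative_in_compose[where f = "\<lambda>\<tau>. (x, \<tau>)"])
      (auto intro!: derivative_eq_intros has_derivative_subset[OF der])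
  then have "((\<lambda>\<tau>. q x \<tau>) has_vector_derivative c) (at t within {t0..tf})"
    by (simp add: has_vector_derivative_def mult.commute)
  then have time: "vector_derivative (\<lambda>\<tau>. q x \<tau>) (at t within {t0..tf}) = c"
    by (rule vector_derivative_within_closed_interval[OF assms(1) t])
  have "range (\<lambda>y. (y, t)) \<subseteq> UNIV \<times> {t0..tf}"
    using t by auto
  from has_derivative_subset[OF der this]
  have "((\<lambda>y. (\<lambda>(y, \<tau>). q y \<tau>) (y, t)) has_derivative (\<lambda>h. (\<lambda>(h, k). a \<bullet> h + c * k) (h, 0))) (at x)"
    by (rule has_derivative_in_compose[where f = "\<lambda>y. (y, t)", rotated]) (auto intro!: derivative_eq_intros)
  then have space: "frechet_derivative (\<lambda>y. q y t) (at x) = (\<lambda>h. a \<bullet> h)"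
    by (intro frechet_derivative_at[symmetric]) simp
  show ?thesis
    by (simp add: krotov_s_def time space)
qed

text \<open>
  Along a process, the first two terms of \<open>krotov_s\<close> are the time derivative of \<open>q (x t) t\<close> by the
  chain rule, so they integrate to the boundary values of \<open>q\<close>. The fundamental theorem of calculus
  tolerates the finitely many times at which the trajectory has no derivative, because
  \<open>q (x t) t\<close> is continuous.
\<close>

lemma krotov_s_has_integral:
  assumes "t0 < tf" and q: "krotov_function t0 tf q"
    and adm: "admissible_process t0 tf x0 f L x u"
  shows "((\<lambda>t. krotov_s t0 tf f L q (x t) (u t) t) has_integral
           q (x tf) tf - q x0 t0 + integral {t0..tf} (\<lambda>t. L t (x t) (u t))) {t0..tf}"
proof -
  obtain D where "finite D" and x_cont: "continuous_on {t0..tf} x" and x_init: "x t0 = x0"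
    and x_der: "\<And>t. t \<in> {t0..tf} - D \<Longrightarrow> (x has_vector_derivative f t (x t) (u t)) (at t within {t0..tf})"
    and L_int: "(\<lambda>t. L t (x t) (u t)) integrable_on {t0..tf}"
    using adm unfolding admissible_process_def by blast
  obtain qx qt where q_cont: "continuous_on (UNIV \<times> {t0..tf}) (\<lambda>(x, t). q x t)"
    and q_der: "\<And>x t. t \<in> {t0..<tf} \<Longrightarrow>
      ((\<lambda>(y, \<tau>). q y \<tau>) has_derivative (\<lambda>(h, k). qx (x, t) \<bullet> h + qt (x, t) * k))
        (at (x, t) within UNIV \<times> {t0..tf})"
    using q unfolding krotov_function_def by blast
  let ?rate = "\<lambda>t. qt (x t, t) + qx (x t, t) \<bullet> f t (x t) (u t)"
  have "(?rate has_integral q (x tf) tf - q (x t0) t0) {t0..tf}"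
  proof (rule fundamental_theorem_of_calculus_interior_strong[OF \<open>finite D\<close>, where f = "\<lambda>t. q (x t) t"])
    fix t assume t: "t \<in> {t0<..<tf} - D"
    then have "((\<lambda>\<tau>. (x \<tau>, \<tau>)) has_derivative (\<lambda>k. (k *\<^sub>R f t (x t) (u t), k))) (at t within {t0..tf})"
      using x_der[of t] by (auto simp: has_vector_derivative_def intro!: derivative_eq_intros)
    moreover have "((\<lambda>(y, \<tau>). q y \<tau>) has_derivative (\<lambda>(h, k). qx (x t, t) \<bullet> h + qt (x t, t) * k))
        (at (x t, t) within (\<lambda>\<tau>. (x \<tau>, \<tau>)) ` {t0..tf})"
      using t by (intro has_derivative_subset[OF q_der]) auto
    ultimately have "((\<lambda>\<tau>. (\<lambda>(y, \<tau>). q y \<tau>) (x \<tau>, \<tau>)) has_derivative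
        (\<lambda>k. (\<lambda>(h, k). qx (x t, t) \<bullet> h + qt (x t, t) * k) (k *\<^sub>R f t (x t) (u t), k))) (at t within {t0..tf})"
      by (rule has_derivative_in_compose)
    then have "((\<lambda>\<tau>. q (x \<tau>) \<tau>) has_vector_derivative ?rate t) (at t within {t0..tf})"
      by (simp add: has_vector_derivative_def algebra_simps)
    then show "((\<lambda>\<tau>. q (x \<tau>) \<tau>) has_vector_derivative ?rate t) (at t)"
      using t at_within_interior[of t "{t0..tf}"] by simp
  next
    show "continuous_on {t0..tf} (\<lambda>t. q (x t) t)"
      using continuous_on_compose2[OF q_cont continuous_on_Pair[OF x_cont continuous_on_id]] by auto
  qed (use \<open>t0 < tf\<close> in auto)
  from has_integral_add[OF this integrable_integral[OF L_int]] show ?thesis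
    unfolding x_init
  proof (rule has_integral_spike_finite[rotated 2])
    fix t assume "t \<in> {t0..tf} - {tf}"
    then show "krotov_s t0 tf f L q (x t) (u t) t = ?rate t + L t (x t) (u t)"
      using \<open>t0 < tf\<close> by (intro krotov_s_eq[OF _ _ q_der]) auto
  qed auto
qed

text \<open>
  Krotov's sufficient condition. By the preceding identity, the cost of any process is
  \<open>krotov_sf + \<integral> krotov_s\<close> up to the constant \<open>q x0 t0\<close>, which depends on the initial state only. A
  process that minimizes both terms over all states and controls, whether or not these can be
  reached, therefore minimizes the cost.
\<close>

theorem krotov_minimizer_optimal:
  assumes "t0 < tf" and q: "krotov_function t0 tf q"
    and adm: "admissible_process t0 tf x0 f L x u"
    and s_min: "\<And>t \<xi> v. t \<in> {t0..<tf} \<Longrightarrow>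
      krotov_s t0 tf f L q (x t) (u t) t \<le> krotov_s t0 tf f L q \<xi> v t"
    and sf_min: "\<And>\<xi>. krotov_sf tf \<Phi> q (x tf) \<le> krotov_sf tf \<Phi> q \<xi>"
    and adm': "admissible_process t0 tf x0 f L x' u'"
  shows "\<Phi> (x tf) + integral {t0..tf} (\<lambda>t. L t (x t) (u t))
    \<le> \<Phi> (x' tf) + integral {t0..tf} (\<lambda>t. L t (x' t) (u' t))"
proof -
  let ?s = "\<lambda>x u t. krotov_s t0 tf f L q (x t) (u t) t"
  note int = krotov_s_has_integral[OF \<open>t0 < tf\<close> q]
  have "q (x tf) tf - q x0 t0 + integral {t0..tf} (\<lambda>t. L t (x t) (u t))
    \<le> q (x' tf) tf - q x0 t0 + integral {t0..tf} (\<lambda>t. L t (x' t) (u' t))"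
  proof (rule has_integral_le)
    \<comment> \<open>The minimum condition leaves out the final time, where \<open>q\<close> need not be differentiable;
      the integrands are set to \<open>0\<close> there.\<close>
    show "((\<lambda>t. if t = tf then 0 else ?s x u t) has_integral
        q (x tf) tf - q x0 t0 + integral {t0..tf} (\<lambda>t. L t (x t) (u t))) {t0..tf}"
      by (rule has_integral_spike_finite[OF _ _ int[OF adm], of "{tf}"]) auto
    show "((\<lambda>t. if t = tf then 0 else ?s x' u' t) has_integral
        q (x' tf) tf - q x0 t0 + integral {t0..tf} (\<lambda>t. L t (x' t) (u' t))) {t0..tf}"
      by (rule has_integral_spike_finite[OF _ _ int[OF adm'], of "{tf}"]) auto
  qed (auto intro!: s_min)
  with sf_min[of "x' tf"] show ?thesis
    by (simp add: krotov_sf_def)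
qed

section \<open>Completing the square\<close>

lemma lqt_quadratic_krotov_has_derivative:
  fixes P :: "real \<Rightarrow> real^'n^'n"
  assumes P: "(P has_vector_derivative P') (at t within S)"
    and g: "(g has_vector_derivative g') (at t within S)"
  shows "((\<lambda>(y, \<tau>). y \<bullet> (P \<tau> *v y) - 2 * (g \<tau> \<bullet> y)) has_derivative
    (\<lambda>(h, k). ((P t + transpose (P t)) *v x - 2 *\<^sub>R g t) \<bullet> h + (x \<bullet> (P' *v x) - 2 * (g' \<bullet> x)) * k))
    (at (x, t) within UNIV \<times> S)"
proof -
  have comp: "((\<lambda>p. G (snd p)) has_derivative (\<lambda>p. snd p *\<^sub>R G')) (at (x, t) within UNIV \<times> S)"
    if "(G has_vector_derivative G') (at t within S)" for G :: "real \<Rightarrow> 'b::real_normed_vector" and G'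
    by (rule has_derivative_in_compose[where f = snd and f' = snd])
      (use that in \<open>auto simp: has_vector_derivative_def intro!: derivative_eq_intros
        intro: has_derivative_subset\<close>)
  have fst: "(fst has_derivative fst) (at (x, t) within UNIV \<times> S)"
    by (auto intro!: derivative_eq_intros)
  have Px: "((\<lambda>p. P (snd p) *v fst p) has_derivative (\<lambda>p. P t *v fst p + (snd p *\<^sub>R P') *v x))
      (at (x, t) within UNIV \<times> S)"
    using bounded_bilinear.FDERIV[OF bounded_bilinear_matrix_vector_mult comp[OF P] fst] by simp
  have "((\<lambda>p. fst p \<bullet> (P (snd p) *v fst p) - 2 * (g (snd p) \<bullet> fst p)) has_derivative
      (\<lambda>p. (x \<bullet> (P t *v fst p + (snd p *\<^sub>R P') *v x) + fst p \<bullet> (P t *v x))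
        - 2 * (g t \<bullet> fst p + (snd p *\<^sub>R g') \<bullet> x))) (at (x, t) within UNIV \<times> S)"
    using has_derivative_diff[OF has_derivative_inner[OF fst Px]
        has_derivative_mult_right[OF has_derivative_inner[OF comp[OF g] fst], of 2]] by simp
  moreover have "(x \<bullet> (P t *v h + (k *\<^sub>R P') *v x) + h \<bullet> (P t *v x)) - 2 * (g t \<bullet> h + (k *\<^sub>R g') \<bullet> x)
    = ((P t + transpose (P t)) *v x - 2 *\<^sub>R g t) \<bullet> h + (x \<bullet> (P' *v x) - 2 * (g' \<bullet> x)) * k" for h k
    by (simp add: inner_matrix_vector_transpose[of x "P t" h] algebra_simps inner_commute
        del: transpose_matrix_vector flip: scaleR_matrix_vector_assoc)
  ultimately show ?thesis
    by (simp add: case_prod_beta')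
qed

definition lqt_feedback ::
  "real^'m^'n \<Rightarrow> real^'m^'m \<Rightarrow> real^'n^'n \<Rightarrow> real^'n \<Rightarrow> real^'n \<Rightarrow> real^'m" where
  "lqt_feedback B R P g x
    = - (1/2) *\<^sub>R ((matrix_inv R ** transpose B ** (transpose P + P)) *v x)
      + (matrix_inv R ** transpose B) *v g"

text \<open>
  The left-hand side is \<open>krotov_s\<close> for the quadratic Krotov function. As a quadratic polynomial in the
  control it has its vertex at the feedback value, which leaves
  \<open>1/4 (S x - 2 g) \<bullet> (M (S x - 2 g))\<close> to be subtracted, with \<open>S = P + P\<^sup>T\<close> and \<open>M = B inv(R) B\<^sup>T\<close>.
  The two differential equations say that the remaining terms that are quadratic and linear in \<open>x\<close>
  cancel. For the quadratic ones only the symmetric part of the equation for \<open>P\<close> counts; since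
  \<open>P M P\<close> and \<open>P\<^sup>T M P\<^sup>T\<close> give the same quadratic form, it reproduces the four products in \<open>1/4 S M S\<close>.
\<close>

lemma lqt_completed_square:
  fixes A P P' :: "real^'n^'n" and B :: "real^'m^'n" and C :: "real^'n^'p"
    and Q :: "real^'p^'p" and R :: "real^'m^'m"
  assumes R: "pos_def R" and Q: "transpose Q = Q"
    and P_ode: "P' + P ** A + transpose A ** P
        - (1/2) *\<^sub>R (P ** B ** matrix_inv R ** transpose B ** P)
        - (1/4) *\<^sub>R (P ** B ** matrix_inv R ** transpose B ** transpose P)
        - (1/4) *\<^sub>R (transpose P ** B ** matrix_inv R ** transpose B ** P)
        + transpose C ** Q ** C = 0"
    and g_ode: "g' + transpose A *v g + (transpose C ** Q) *v z
        - (1/2) *\<^sub>R (((P + transpose P) ** B ** matrix_inv R ** transpose B) *v g) = 0"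
  shows "(x \<bullet> (P' *v x) - 2 * (g' \<bullet> x)) + ((P + transpose P) *v x - 2 *\<^sub>R g) \<bullet> (A *v x + B *v u)
      + ((C *v x - z) \<bullet> (Q *v (C *v x - z)) + u \<bullet> (R *v u))
    = (u - lqt_feedback B R P g x) \<bullet> (R *v (u - lqt_feedback B R P g x))
      + (z \<bullet> (Q *v z) - g \<bullet> ((B ** matrix_inv R ** transpose B) *v g))"
proof -
  define N where "N = matrix_inv R"
  define M where "M = B ** N ** transpose B"
  define p where "p = P *v x"
  define r where "r = transpose P *v x"
  define w where "w = transpose B *v (p + r - 2 *\<^sub>R g)"
  have R_sym: "transpose R = R"
    using R by (simp add: pos_def_def)
  have N_sym: "transpose N = N"
    unfolding N_def by (intro transpose_matrix_inv pos_def_invertible R R_sym)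
  have RN: "R *v (N *v v) = v" for v
    by (simp add: matrix_vector_mul_assoc N_def matrix_inv_inverse pos_def_invertible[OF R])
  have M_sym: "transpose M = M"
    by (simp add: M_def matrix_transpose_mul N_sym matrix_mul_assoc)
  note move = inner_matrix_vector_transpose
  have fb: "lqt_feedback B R P g x = - (1/2) *\<^sub>R (N *v w)"
    by (simp add: lqt_feedback_def w_def p_def r_def N_def algebra_simps scaleR_add_right
        del: transpose_matrix_vector flip: matrix_vector_mul_assoc)
  have square: "(u - lqt_feedback B R P g x) \<bullet> (R *v (u - lqt_feedback B R P g x))
      = u \<bullet> (R *v u) + w \<bullet> u + 1/4 * (w \<bullet> (N *v w))"
  proof -
    have "(N *v w) \<bullet> (R *v u) = w \<bullet> u"
      using move[of "N *v w" R u] by (simp add: R_sym RN)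
    then show ?thesis
      by (simp add: fb RN algebra_simps inner_commute)
  qed
  have Bw: "(p + r - 2 *\<^sub>R g) \<bullet> (B *v v) = w \<bullet> v" for v
    unfolding w_def by (rule inner_matrix_vector_transpose)
  have wNw: "w \<bullet> (N *v w) = (p + r - 2 *\<^sub>R g) \<bullet> (M *v (p + r - 2 *\<^sub>R g))"
    by (simp add: M_def Bw w_def[symmetric] del: transpose_matrix_vector flip: matrix_vector_mul_assoc)
  have MM: "a \<bullet> (M *v b) = b \<bullet> (M *v a)" for a b
    using move[of a M b] by (simp add: M_sym inner_commute)
  have QQ: "a \<bullet> (Q *v b) = b \<bullet> (Q *v a)" for a b
    using move[of a Q b] by (simp add: Q inner_commute)
  have "x \<bullet> ((P' + P ** A + transpose A ** P
        - (1/2) *\<^sub>R (P ** M ** P) - (1/4) *\<^sub>R (P ** M ** transpose P)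
        - (1/4) *\<^sub>R (transpose P ** M ** P) + transpose C ** Q ** C) *v x) = 0"
    using P_ode by (simp add: M_def N_def matrix_mul_assoc)
  then have xP: "x \<bullet> (P' *v x) + r \<bullet> (A *v x) + p \<bullet> (A *v x)
      - 1/2 * (r \<bullet> (M *v p)) - 1/4 * (r \<bullet> (M *v r)) - 1/4 * (p \<bullet> (M *v p))
      + (C *v x) \<bullet> (Q *v (C *v x)) = 0"
    by (simp add: algebra_simps move[of x P] move[of x "transpose P"] move[of x "transpose A"]
        move[of x "transpose C"] p_def[symmetric] r_def[symmetric] inner_commute[of "A *v x" p]
        del: transpose_matrix_vector flip: matrix_vector_mul_assoc scaleR_matrix_vector_assoc)
  have "x \<bullet> (g' + transpose A *v g + (transpose C ** Q) *v z
        - (1/2) *\<^sub>R (((P + transpose P) ** M) *v g)) = 0"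
    using g_ode by (simp add: M_def N_def matrix_mul_assoc)
  then have xg: "g' \<bullet> x + g \<bullet> (A *v x) + (C *v x) \<bullet> (Q *v z)
      - 1/2 * (p \<bullet> (M *v g)) - 1/2 * (r \<bullet> (M *v g)) = 0"
    by (simp add: algebra_simps move[of x P] move[of x "transpose P"] move[of x "transpose A"]
        move[of x "transpose C"] p_def[symmetric] r_def[symmetric] inner_commute[of "A *v x" g]
        inner_commute[of x g']
        del: transpose_matrix_vector flip: matrix_vector_mul_assoc scaleR_matrix_vector_assoc)
  have PP: "(P + transpose P) *v x = p + r"
    by (simp add: p_def r_def matrix_vector_mult_add_rdistrib)
  have "x \<bullet> (P' *v x) - 2 * (g' \<bullet> x) + (p + r - 2 *\<^sub>R g) \<bullet> (A *v x)
      + (C *v x - z) \<bullet> (Q *v (C *v x - z))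
    = 1/4 * (w \<bullet> (N *v w)) + z \<bullet> (Q *v z) - g \<bullet> (M *v g)"
    unfolding wNw using xP xg by (simp add: algebra_simps MM[of r p] MM[of g p] MM[of g r] QQ[of z "C *v x"])
  then show ?thesis
    unfolding square PP inner_add_right[of _ "A *v x"] Bw M_def N_def by linarith
qed

text \<open>
  With the final values prescribed for \<open>P\<close> and \<open>g\<close>, the function \<open>q\<close> agrees with the terminal cost up to
  a constant. Symmetry of \<open>F\<close> makes the two mixed terms of the terminal cost equal.
\<close>

lemma lqt_terminal_completed_square:
  fixes F :: "real^'p^'p" and C :: "real^'n^'p"
  assumes "transpose F = F"
  shows "(C *v x - z) \<bullet> (F *v (C *v x - z))
      - (x \<bullet> ((transpose C ** F ** C) *v x) - 2 * (((transpose C ** F) *v z) \<bullet> x)) = z \<bullet> (F *v z)"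
proof -
  have FF: "a \<bullet> (F *v b) = b \<bullet> (F *v a)" for a b
    using inner_matrix_vector_transpose[of a F b] assms by (simp add: inner_commute)
  have "x \<bullet> (transpose C *v y) = (C *v x) \<bullet> y" for y
    using inner_matrix_vector_transpose[of x "transpose C" y] by simp
  then show ?thesis
    by (simp add: algebra_simps inner_commute[of _ x] FF[of z "C *v x"]
        del: transpose_matrix_vector flip: matrix_vector_mul_assoc)
qed


section \<open>The closed loop and its optimality\<close>

text \<open>
  The feedback is affine in the state, so the closed loop is a linear differential equation with
  coefficients that are continuous up to the final time; it therefore has a solution on the whole
  horizon.
\<close>

lemma lqt_closed_loop_admissible:
  fixes A :: "real \<Rightarrow> real^'n^'n" and B :: "real \<Rightarrow> real^'m^'n" and C :: "real \<Rightarrow> real^'n^'p"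
  assumes "t0 \<le> tf"
    and cont: "continuous_on {t0..tf} A" "continuous_on {t0..tf} B" "continuous_on {t0..tf} C"
      "continuous_on {t0..tf} Q" "continuous_on {t0..tf} R" "continuous_on {t0..tf} z"
      "continuous_on {t0..tf} P" "continuous_on {t0..tf} g"
    and R: "\<And>t. t \<in> {t0..tf} \<Longrightarrow> pos_def (R t)"
  obtains x where "admissible_process t0 tf x0 (lqt_dynamics A B) (lqt_running C Q R z) x
    (\<lambda>t. lqt_feedback (B t) (R t) (P t) (g t) (x t))"
proof -
  let ?\<kappa> = "\<lambda>t. lqt_feedback (B t) (R t) (P t) (g t)"
  have R_inv: "continuous_on {t0..tf} (\<lambda>t. matrix_inv (R t))"
    by (intro continuous_on_matrix_inv cont pos_def_invertible R)
  define G where "G t = A t - (1/2) *\<^sub>R (B t ** matrix_inv (R t) ** transpose (B t) ** (transpose (P t) + P t))" for t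
  define h where "h t = (B t ** matrix_inv (R t) ** transpose (B t)) *v g t" for t
  have "continuous_on {t0..tf} G" "continuous_on {t0..tf} h"
    unfolding G_def h_def by (intro continuous_intros cont R_inv)+
  then obtain x where "x t0 = x0"
    and x: "\<And>t. t \<in> {t0..tf} \<Longrightarrow> (x has_vector_derivative G t *v x t + h t) (at t within {t0..tf})"
    using linear_ivp_solution_exists[OF \<open>t0 \<le> tf\<close>] by metis
  have "G t *v y + h t = lqt_dynamics A B t y (?\<kappa> t y)" for t y
    by (simp add: G_def h_def lqt_dynamics_def lqt_feedback_def algebra_simps
        del: transpose_matrix_vector flip: matrix_vector_mul_assoc scaleR_matrix_vector_assoc)
  with x have "(x has_vector_derivative lqt_dynamics A B t (x t) (?\<kappa> t (x t))) (at t within {t0..tf})"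
    if "t \<in> {t0..tf}" for t
    using that by simp
  moreover have x_cont: "continuous_on {t0..tf} x"
    by (rule continuous_on_vector_derivative) (rule x)
  moreover have "(\<lambda>t. lqt_running C Q R z t (x t) (?\<kappa> t (x t))) integrable_on {t0..tf}"
    unfolding lqt_running_def lqt_error_def lqt_feedback_def
    by (intro integrable_continuous_real continuous_intros cont R_inv x_cont)
  ultimately show thesis
    using \<open>x t0 = x0\<close> by (intro that[of x]) (auto simp: admissible_process_def)
qed

theorem corollary2:
  fixes A :: "real \<Rightarrow> real^'n^'n" and B :: "real \<Rightarrow> real^'m^'n" and C :: "real \<Rightarrow> real^'n^'p"
    and Q F :: "real \<Rightarrow> real^'p^'p" and R :: "real \<Rightarrow> real^'m^'m" and z :: "real \<Rightarrow> real^'p"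
    and t0 tf :: real and x0 :: "real^'n"
    and P P' :: "real \<Rightarrow> real^'n^'n" and g g' :: "real \<Rightarrow> real^'n"
  assumes horizon: "t0 < tf"
    and coefficients: "continuous_on {t0..tf} A" "continuous_on {t0..tf} B"
      "continuous_on {t0..tf} C" "continuous_on {t0..tf} Q" "continuous_on {t0..tf} R"
      "continuous_on {t0..tf} z"
    and Q_psd: "\<And>t. t \<in> {t0..tf} \<Longrightarrow> pos_semidef (Q t)"
    and R_pd: "\<And>t. t \<in> {t0..tf} \<Longrightarrow> pos_def (R t)"
    and F_sym: "transpose (F tf) = F tf"
    and P_diff: "\<And>t. t \<in> {t0..<tf} \<Longrightarrow> (P has_vector_derivative P' t) (at t within {t0..tf})"
    and P_cont: "continuous_on {t0..tf} P"
    and P_ode: "\<And>t. t \<in> {t0..<tf} \<Longrightarrow>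
      P' t + P t ** A t + transpose (A t) ** P t
        - (1/2) *\<^sub>R (P t ** B t ** matrix_inv (R t) ** transpose (B t) ** P t)
        - (1/4) *\<^sub>R (P t ** B t ** matrix_inv (R t) ** transpose (B t) ** transpose (P t))
        - (1/4) *\<^sub>R (transpose (P t) ** B t ** matrix_inv (R t) ** transpose (B t) ** P t)
        + transpose (C t) ** Q t ** C t = 0"
    and P_final: "P tf = transpose (C tf) ** F tf ** C tf"
    and g_diff: "\<And>t. t \<in> {t0..<tf} \<Longrightarrow> (g has_vector_derivative g' t) (at t within {t0..tf})"
    and g_cont: "continuous_on {t0..tf} g"
    and g_ode: "\<And>t. t \<in> {t0..<tf} \<Longrightarrow>
      g' t + transpose (A t) *v g t + (transpose (C t) ** Q t) *v z t
        - (1/2) *\<^sub>R (((P t + transpose (P t)) ** B t ** matrix_inv (R t) ** transpose (B t)) *v g t)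
      = 0"
    and g_final: "g tf = (transpose (C tf) ** F tf) *v z tf"
  shows "solving_function t0 tf x0 (lqt_dynamics A B) (lqt_running C Q R z) (lqt_terminal C F z tf)
           (\<lambda>x t. x \<bullet> (P t *v x) - 2 * (g t \<bullet> x))
    \<and> lqt_global_optimal_law A B C Q R F z t0 tf x0
        (\<lambda>t x. - (1/2) *\<^sub>R ((matrix_inv (R t) ** transpose (B t) ** (transpose (P t) + P t)) *v x)
                + (matrix_inv (R t) ** transpose (B t)) *v g t)"
proof -
  let ?f = "lqt_dynamics A B"
  let ?L = "lqt_running C Q R z"
  let ?\<Phi> = "lqt_terminal C F z tf"
  let ?q = "\<lambda>x t. x \<bullet> (P t *v x) - 2 * (g t \<bullet> x)"
  let ?\<kappa> = "\<lambda>t. lqt_feedback (B t) (R t) (P t) (g t)"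
  let ?adm = "admissible_process t0 tf x0 ?f ?L"
  note q_der = lqt_quadratic_krotov_has_derivative[OF P_diff g_diff]

  have R_inv: "continuous_on {t0..tf} (\<lambda>t. matrix_inv (R t))"
    by (intro continuous_on_matrix_inv coefficients pos_def_invertible R_pd)
  \<comment> \<open>The differential equations express \<open>P'\<close> and \<open>g'\<close> through continuous functions; this is what
    makes \<open>q\<close> continuously differentiable.\<close>
  have P'_cont: "continuous_on {t0..<tf} P'"
  proof -
    have "continuous_on {t0..tf} (\<lambda>t.
        (1/2) *\<^sub>R (P t ** B t ** matrix_inv (R t) ** transpose (B t) ** P t)
        + (1/4) *\<^sub>R (P t ** B t ** matrix_inv (R t) ** transpose (B t) ** transpose (P t))
        + (1/4) *\<^sub>R (transpose (P t) ** B t ** matrix_inv (R t) ** transpose (B t) ** P t)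
        - transpose (C t) ** Q t ** C t - P t ** A t - transpose (A t) ** P t)" (is "continuous_on _ ?E")
      by (intro continuous_intros coefficients R_inv P_cont)
    then have "continuous_on {t0..<tf} ?E"
      by (rule continuous_on_subset) auto
    moreover have "P' t = ?E t" if "t \<in> {t0..<tf}" for t
      by (rule eq_iff_diff_eq_0[THEN iffD2]) (use P_ode[OF that] in \<open>simp add: algebra_simps\<close>)
    ultimately show ?thesis
      by (rule continuous_on_eq[OF _ sym])
  qed
  have g'_cont: "continuous_on {t0..<tf} g'"
  proof -
    have "continuous_on {t0..tf} (\<lambda>t.
        (1/2) *\<^sub>R (((P t + transpose (P t)) ** B t ** matrix_inv (R t) ** transpose (B t)) *v g t)
        - transpose (A t) *v g t - (transpose (C t) ** Q t) *v z t)" (is "continuous_on _ ?E")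
      by (intro continuous_intros coefficients R_inv P_cont g_cont)
    then have "continuous_on {t0..<tf} ?E"
      by (rule continuous_on_subset) auto
    moreover have "g' t = ?E t" if "t \<in> {t0..<tf}" for t
      by (rule eq_iff_diff_eq_0[THEN iffD2]) (use g_ode[OF that] in \<open>simp add: algebra_simps\<close>)
    ultimately show ?thesis
      by (rule continuous_on_eq[OF _ sym])
  qed

  have krotov: "krotov_function t0 tf ?q"
  proof -
    have snd: "continuous_on (UNIV \<times> S) (\<lambda>p. H (snd p))"
      if "continuous_on S H" for S and H :: "real \<Rightarrow> 'b::topological_space"
      by (rule continuous_on_compose2[OF that]) (auto intro!: continuous_intros)
    have P_cont': "continuous_on {t0..<tf} P" and g_cont': "continuous_on {t0..<tf} g"
      by (auto intro: continuous_on_subset[OF P_cont] continuous_on_subset[OF g_cont])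
    have "continuous_on (UNIV \<times> {t0..tf}) (\<lambda>(x, t). ?q x t)"
      unfolding case_prod_beta' by (intro continuous_intros snd P_cont g_cont)
    moreover have "continuous_on (UNIV \<times> {t0..<tf})
        (\<lambda>p. (P (snd p) + transpose (P (snd p))) *v fst p - 2 *\<^sub>R g (snd p))"
      by (intro continuous_intros snd P_cont' g_cont')
    moreover have "continuous_on (UNIV \<times> {t0..<tf})
        (\<lambda>p. fst p \<bullet> (P' (snd p) *v fst p) - 2 * (g' (snd p) \<bullet> fst p))"
      by (intro continuous_intros snd P'_cont g'_cont)
    moreover have "((\<lambda>(y, \<tau>). ?q y \<tau>) has_derivative
        (\<lambda>(h, k). ((P (snd (x, t)) + transpose (P (snd (x, t)))) *v fst (x, t) - 2 *\<^sub>R g (snd (x, t))) \<bullet> h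
          + (fst (x, t) \<bullet> (P' (snd (x, t)) *v fst (x, t)) - 2 * (g' (snd (x, t)) \<bullet> fst (x, t))) * k))
        (at (x, t) within UNIV \<times> {t0..tf})" if "t \<in> {t0..<tf}" for x t
      unfolding fst_conv snd_conv by (rule q_der[OF that that])
    ultimately show ?thesis
      unfolding krotov_function_def by (intro conjI exI ballI allI)
  qed

  have s_eq: "krotov_s t0 tf ?f ?L ?q \<xi> v t
      = (v - ?\<kappa> t \<xi>) \<bullet> (R t *v (v - ?\<kappa> t \<xi>))
        + (z t \<bullet> (Q t *v z t) - g t \<bullet> ((B t ** matrix_inv (R t) ** transpose (B t)) *v g t))"
    if t: "t \<in> {t0..<tf}" for t \<xi> v
  proof -
    have "t \<in> {t0..tf}"
      using t by auto
    then show ?thesis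
      using Q_psd R_pd
      unfolding krotov_s_eq[OF horizon \<open>t \<in> {t0..tf}\<close> q_der[OF t t]]
        lqt_dynamics_def lqt_running_def lqt_error_def
      by (intro lqt_completed_square P_ode g_ode t) (auto simp: pos_semidef_def)
  qed
  have s_min: "krotov_s t0 tf ?f ?L ?q y (?\<kappa> t y) t \<le> krotov_s t0 tf ?f ?L ?q \<xi> v t"
    if t: "t \<in> {t0..<tf}" for t y \<xi> v
  proof -
    have "0 \<le> w \<bullet> (R t *v w)" for w
      using R_pd[of t] t by (cases "w = 0") (auto simp: pos_def_def intro: less_imp_le)
    then show ?thesis
      by (simp add: s_eq[OF t])
  qed
  have sf_min: "krotov_sf tf ?\<Phi> ?q y \<le> krotov_sf tf ?\<Phi> ?q \<xi>" for y \<xi>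
    unfolding krotov_sf_def lqt_terminal_def lqt_error_def P_final g_final
    by (simp only: lqt_terminal_completed_square[OF F_sym])

  obtain x where x: "?adm x (\<lambda>t. ?\<kappa> t (x t))"
    by (rule lqt_closed_loop_admissible[OF less_imp_le[OF horizon] coefficients P_cont g_cont R_pd])
  have solving: "solving_function t0 tf x0 ?f ?L ?\<Phi> ?q"
    unfolding solving_function_def
    by (intro conjI exI[of _ x] exI[of _ "\<lambda>t. ?\<kappa> t (x t)"] ballI allI krotov x s_min sf_min)
  have "lqt_cost C Q R F z t0 tf y (\<lambda>t. ?\<kappa> t (y t)) \<le> lqt_cost C Q R F z t0 tf x' u'"
    if "?adm y (\<lambda>t. ?\<kappa> t (y t))" and "?adm x' u'" for y x' u'
    using krotov_minimizer_optimal[OF horizon krotov that(1) s_min sf_min that(2)]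
    by (simp add: lqt_cost_def)
  with x have "lqt_global_optimal_law A B C Q R F z t0 tf x0 ?\<kappa>"
    unfolding lqt_global_optimal_law_def Let_def by blast
  with solving show ?thesis
    unfolding lqt_feedback_def[abs_def] by (rule conjI)
qed

end
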